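(* Let $\Omega\subset\mathbb{R}^2$ be a domain (a connected nonempty open set), let $f:\Omega\to\mathbb{R}$ be a smooth function, and suppose its graph $S=\{(x,y,f(x,y)):(x,y)\in\Omega\}\subset\mathcal{H}_3$ is a minimal graph in the Heisenberg group. Then $S$ is a plane (that is, $f(x,y)=ax+by+c$ on $\Omega$ for some constants $a,b,c\in\mathbb{R}$) if and only if the Gauss map $\phi:\Omega\to\mathcal{P}$ of $S$ is conformal.
   Context: The Heisenberg group $\mathcal{H}_3$ is $\mathbb{R}^3$ with the product $(a,b,c)*(x,y,z)=(a+x,\,b+y,\,c+z+\frac{ay-bx}{2})$ and the left-invariant Riemannian metric $ds^2=dx^2+dy^2+\left(\frac12 y\,dx-\frac12 x\,dy+dz\right)^2$. The graph $S$ is parametrized by $X(x,y)=(x,y,f(x,y))$, $(x,y)\in\Omega$. Write $p=f_x+\frac y2$, $q=f_y-\frac x2$. The induced metric on $\Omega$ is $(1+p^2)\,dx^2+2pq\,dx\,dy+(1+q^2)\,dy^2$. The graph is minimal if its mean curvature vanishes, i.e. if $$(1+q^2)f_{xx}-2pq\,f_{xy}+(1+p^2)f_{yy}=0\quad\text{on }\Omega.$$ The Gans model $\mathcal{P}$ of the hyperbolic plane is $\mathbb{R}^2$ with coordinates $(u,v)$ and the metric $$h=\frac{(1+v^2)\,du^2-2uv\,du\,dv+(1+u^2)\,dv^2}{1+u^2+v^2}.$$ The Gauss map of $S$ (the unit normal left-translated to the identity, followed by central projection from the origin of the open upper hemisphere onto the plane $z=1$, identified with $\mathcal{P}$), written in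 the parametrization $X$, is $\phi(x,y)=(-p(x,y),-q(x,y))$. The Gauss map is called conformal if $d\phi_{(x,y)}\neq0$ for all $(x,y)\in\Omega$ and there is a function $\lambda>0$ on $\Omega$ such that, for all $(x,y)\in\Omega$ and all tangent vectors $\mathbf{u},\mathbf{v}$ at $(x,y)$, $$\langle d\phi(\mathbf{u}),d\phi(\mathbf{v})\rangle_{\phi(x,y)}=\lambda(x,y)\,\langle dX(\mathbf{u}),dX(\mathbf{v})\rangle_{X(x,y)},$$ where the left inner product is that of $h$ and the right one that of $ds^2$. *)

theory Defs
  imports "HOL-Analysis.Analysis"
begin

section \<open>Smooth functions\<close>

fun Ck_on :: "nat \<Rightarrow> 'a::real_normed_vector set \<Rightarrow> ('a \<Rightarrow> 'b::real_normed_vector) \<Rightarrow> bool" where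
  "Ck_on 0 S f \<longleftrightarrow> continuous_on S f"
| "Ck_on (Suc k) S f \<longleftrightarrow>
     (\<forall>z\<in>S. f differentiable (at z)) \<and> (\<forall>v. Ck_on k S (\<lambda>z. frechet_derivative f (at z) v))"

text \<open>Only meant for open \<open>S\<close>: derivatives are taken with respect to the full neighbourhood filter.\<close>

definition smooth_on :: "'a::real_normed_vector set \<Rightarrow> ('a \<Rightarrow> 'b::real_normed_vector) \<Rightarrow> bool" where
  "smooth_on S f \<longleftrightarrow> (\<forall>k. Ck_on k S f)"


section \<open>The Heisenberg group\<close>

fun heis_mult :: "real \<times> real \<times> real \<Rightarrow> real \<times> real \<times> real \<Rightarrow> real \<times> real \<times> real" where
  "heis_mult (a, b, c) (x, y, z) = (a + x, b + y, c + z + (a * y - b * x) / 2)"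

text \<open>\<open>heis_metric m v w\<close> is the inner product at the point \<open>m\<close> of the tangent vectors \<open>v\<close>, \<open>w\<close>,
  given by their components with respect to the coordinates.\<close>

fun heis_metric :: "real \<times> real \<times> real \<Rightarrow> real \<times> real \<times> real \<Rightarrow> real \<times> real \<times> real \<Rightarrow> real" where
  "heis_metric (x, y, z) (v1, v2, v3) (w1, w2, w3) =
     v1 * w1 + v2 * w2
     + (y / 2 * v1 - x / 2 * v2 + v3) * (y / 2 * w1 - x / 2 * w2 + w3)"

text \<open>The group inverse of \<open>m\<close> is \<open>- m\<close>, the componentwise negative.\<close>

lemma heis_mult_uminus: "heis_mult (- m) m = 0" "heis_mult m (- m) = 0"
  by (cases m; simp add: zero_prod_def)+

definition translate_to_identity ::
    "real \<times> real \<times> real \<Rightarrow> real \<times> real \<times> real \<Rightarrow> real \<times> real \<times> real" where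
  "translate_to_identity m = frechet_derivative (heis_mult (- m)) (at m)"

text \<open>The Christoffel symbols of the first kind, \<open>\<langle>\<nabla>\<^bsub>u\<^esub> v, w\<rangle>\<close> for the Levi-Civita connection
  and coordinate-constant vector fields \<open>u\<close>, \<open>v\<close>, \<open>w\<close> (Koszul formula).\<close>

definition heis_christoffel ::
    "real \<times> real \<times> real \<Rightarrow> real \<times> real \<times> real \<Rightarrow> real \<times> real \<times> real \<Rightarrow> real \<times> real \<times> real \<Rightarrow> real" where
  "heis_christoffel m u v w =
     (frechet_derivative (\<lambda>m. heis_metric m v w) (at m) u
      + frechet_derivative (\<lambda>m. heis_metric m u w) (at m) v
      - frechet_derivative (\<lambda>m. heis_metric m u v) (at m) w) / 2"


section \<open>The Gans model of the hyperbolic plane\<close>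

fun gans_metric :: "real \<times> real \<Rightarrow> real \<times> real \<Rightarrow> real \<times> real \<Rightarrow> real" where
  "gans_metric (u, v) (a1, a2) (b1, b2) =
     ((1 + v\<^sup>2) * a1 * b1 - u * v * (a1 * b2 + a2 * b1) + (1 + u\<^sup>2) * a2 * b2) / (1 + u\<^sup>2 + v\<^sup>2)"


section \<open>Geometry of graphs\<close>

definition graph_param :: "(real \<times> real \<Rightarrow> real) \<Rightarrow> real \<times> real \<Rightarrow> real \<times> real \<times> real" where
  "graph_param f z = (fst z, snd z, f z)"

definition graph_tangent :: "(real \<times> real \<Rightarrow> real) \<Rightarrow> real \<times> real \<Rightarrow> real \<times> real \<Rightarrow> real \<times> real \<times> real" where
  "graph_tangent f z = frechet_derivative (graph_param f) (at z)"

definition first_form :: "(real \<times> real \<Rightarrow> real) \<Rightarrow> real \<times> real \<Rightarrow> real \<times> real \<Rightarrow> real \<times> real \<Rightarrow> real" where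
  "first_form f z u v = heis_metric (graph_param f z) (graph_tangent f z u) (graph_tangent f z v)"

text \<open>Of the two unit normals, the one whose left translate to the identity lies in the open upper
  hemisphere.\<close>

definition unit_normal :: "(real \<times> real \<Rightarrow> real) \<Rightarrow> real \<times> real \<Rightarrow> real \<times> real \<times> real" where
  "unit_normal f z = (THE n.
     (\<forall>u. heis_metric (graph_param f z) n (graph_tangent f z u) = 0) \<and>
     heis_metric (graph_param f z) n n = 1 \<and>
     0 < snd (snd (translate_to_identity (graph_param f z) n)))"

fun central_projection :: "real \<times> real \<times> real \<Rightarrow> real \<times> real" where
  "central_projection (a, b, c) = (a / c, b / c)"

definition gauss_map :: "(real \<times> real \<Rightarrow> real) \<Rightarrow> real \<times> real \<Rightarrow> real \<times> real" where
  "gauss_map f z =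
     central_projection (translate_to_identity (graph_param f z) (unit_normal f z))"

definition conformal_gauss_map :: "(real \<times> real) set \<Rightarrow> (real \<times> real \<Rightarrow> real) \<Rightarrow> bool" where
  "conformal_gauss_map \<Omega> f \<longleftrightarrow>
     (\<forall>z\<in>\<Omega>. frechet_derivative (gauss_map f) (at z) \<noteq> (\<lambda>_. 0)) \<and>
     (\<exists>l. (\<forall>z\<in>\<Omega>. 0 < l z) \<and>
       (\<forall>z\<in>\<Omega>. \<forall>u v.
          gans_metric (gauss_map f z) (frechet_derivative (gauss_map f) (at z) u)
            (frechet_derivative (gauss_map f) (at z) v)
          = l z * first_form f z u v))"

text \<open>\<open>\<langle>\<nabla>\<^bsub>dX(v)\<^esub> dX(u), n\<rangle>\<close>, expanded in coordinates as second derivative plus Christoffel term.\<close>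

definition second_form :: "(real \<times> real \<Rightarrow> real) \<Rightarrow> real \<times> real \<Rightarrow> real \<times> real \<Rightarrow> real \<times> real \<Rightarrow> real" where
  "second_form f z u v =
     heis_metric (graph_param f z) (frechet_derivative (\<lambda>z. graph_tangent f z u) (at z) v) (unit_normal f z)
     + heis_christoffel (graph_param f z) (graph_tangent f z u) (graph_tangent f z v) (unit_normal f z)"

definition mean_curvature :: "(real \<times> real \<Rightarrow> real) \<Rightarrow> real \<times> real \<Rightarrow> real" where
  "mean_curvature f z =
     (let I = first_form f z; II = second_form f z; e1 = (1, 0); e2 = (0, 1) in
       (I e2 e2 * II e1 e1 - 2 * I e1 e2 * II e1 e2 + I e1 e1 * II e2 e2)
       / (2 * (I e1 e1 * I e2 e2 - (I e1 e2)\<^sup>2)))"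

definition minimal_graph :: "(real \<times> real) set \<Rightarrow> (real \<times> real \<Rightarrow> real) \<Rightarrow> bool" where
  "minimal_graph \<Omega> f \<longleftrightarrow> (\<forall>z\<in>\<Omega>. mean_curvature f z = 0)"


section \<open>Coordinate expressions\<close>

abbreviation partial_x :: "(real \<times> real \<Rightarrow> real) \<Rightarrow> real \<times> real \<Rightarrow> real" where
  "partial_x f z \<equiv> frechet_derivative f (at z) (1, 0)"

abbreviation partial_y :: "(real \<times> real \<Rightarrow> real) \<Rightarrow> real \<times> real \<Rightarrow> real" where
  "partial_y f z \<equiv> frechet_derivative f (at z) (0, 1)"

definition slope_p :: "(real \<times> real \<Rightarrow> real) \<Rightarrow> real \<times> real \<Rightarrow> real" where
  "slope_p f z = partial_x f z + snd z / 2"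

definition slope_q :: "(real \<times> real \<Rightarrow> real) \<Rightarrow> real \<times> real \<Rightarrow> real" where
  "slope_q f z = partial_y f z - fst z / 2"

lemma translate_to_identity_eq:
  "translate_to_identity (a, b, c) (v1, v2, v3) = (v1, v2, v3 + (b * v1 - a * v2) / 2)"
proof -
  have *: "heis_mult (- (a, b, c)) =
      (\<lambda>w. (fst w - a, fst (snd w) - b, snd (snd w) - c + (b * fst w - a * fst (snd w)) / 2))"
    by (auto simp: fun_eq_iff)
  have "(heis_mult (- (a, b, c)) has_derivative
      (\<lambda>v. (fst v, fst (snd v), snd (snd v) + (b * fst v - a * fst (snd v)) / 2))) (at (a, b, c))"
    unfolding * by (auto intro!: derivative_eq_intros)
  from frechet_derivative_at[OF this] show ?thesis
    by (simp add: translate_to_identity_def fun_eq_iff)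
qed

lemma heis_metric_derivative:
  "frechet_derivative (\<lambda>m. heis_metric m (v1, v2, v3) (w1, w2, w3)) (at (x, y, z)) (u1, u2, u3) =
     (u2 / 2 * v1 - u1 / 2 * v2) * (y / 2 * w1 - x / 2 * w2 + w3)
     + (y / 2 * v1 - x / 2 * v2 + v3) * (u2 / 2 * w1 - u1 / 2 * w2)"
proof -
  have *: "(\<lambda>m. heis_metric m (v1, v2, v3) (w1, w2, w3)) =
      (\<lambda>m. v1 * w1 + v2 * w2 + (fst (snd m) / 2 * v1 - fst m / 2 * v2 + v3)
         * (fst (snd m) / 2 * w1 - fst m / 2 * w2 + w3))"
    by (auto simp: fun_eq_iff)
  have "((\<lambda>m. heis_metric m (v1, v2, v3) (w1, w2, w3)) has_derivative
      (\<lambda>u. (fst (snd u) / 2 * v1 - fst u / 2 * v2) * (y / 2 * w1 - x / 2 * w2 + w3)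
     + (y / 2 * v1 - x / 2 * v2 + v3) * (fst (snd u) / 2 * w1 - fst u / 2 * w2))) (at (x, y, z))"
    unfolding * by (auto intro!: derivative_eq_intros simp: fun_eq_iff field_simps)
  from frechet_derivative_at[OF this] show ?thesis
    by (simp add: fun_eq_iff)
qed

lemma graph_tangent_eq:
  assumes "f differentiable (at z)"
  shows "graph_tangent f z u = (fst u, snd u, fst u * partial_x f z + snd u * partial_y f z)"
proof -
  let ?D = "frechet_derivative f (at z)"
  have D: "(f has_derivative ?D) (at z)"
    using assms frechet_derivative_works by blast
  have "(graph_param f has_derivative (\<lambda>u. (fst u, snd u, ?D u))) (at z)"
    unfolding graph_param_def[abs_def] by (auto intro!: derivative_eq_intros D)
  from frechet_derivative_at[OF this]
  have 1: "graph_tangent f z u = (fst u, snd u, ?D u)"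
    unfolding graph_tangent_def by metis
  have lin: "linear ?D" using D has_derivative_linear by blast
  have "?D u = ?D (fst u *\<^sub>R (1, 0) + snd u *\<^sub>R (0, 1))"
    by simp
  also have "\<dots> = fst u * partial_x f z + snd u * partial_y f z"
    by (simp only: linear_add[OF lin] linear_scale[OF lin] real_scaleR_def)
  finally show ?thesis using 1 by simp
qed

lemma unit_normal_eq:
  assumes "f differentiable (at z)"
  defines "p \<equiv> slope_p f z" and "q \<equiv> slope_q f z"
  shows "unit_normal f z =
    (1 / sqrt (1 + p\<^sup>2 + q\<^sup>2)) *\<^sub>R (- p, - q, 1 + (snd z * p - fst z * q) / 2)"
proof -
  obtain x y where z: "z = (x, y)" by (cases z)
  define W where "W = sqrt (1 + p\<^sup>2 + q\<^sup>2)"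
  have W2: "W\<^sup>2 = 1 + p\<^sup>2 + q\<^sup>2" and W: "W > 0"
    by (auto simp: W_def add_pos_nonneg)
  define n0 where "n0 = (1 / W) *\<^sub>R (- p, - q, 1 + (y * p - x * q) / 2)"
  let ?P = "\<lambda>n. (\<forall>u. heis_metric (graph_param f z) n (graph_tangent f z u) = 0) \<and>
     heis_metric (graph_param f z) n n = 1 \<and>
     0 < snd (snd (translate_to_identity (graph_param f z) n))"
  have fx: "partial_x f z = p - y / 2" and fy: "partial_y f z = q + x / 2"
    by (auto simp: p_def q_def slope_p_def slope_q_def z)
  have T: "graph_tangent f (x, y) u = (fst u, snd u, fst u * (p - y / 2) + snd u * (q + x / 2))" for u
    using graph_tangent_eq[OF assms(1), of u] unfolding fx fy by (simp add: z)
  have char: "?P (n1, n2, n3) \<longleftrightarrow>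
      n1 = - p * t \<and> n2 = - q * t \<and> n1\<^sup>2 + n2\<^sup>2 + t\<^sup>2 = 1 \<and> 0 < t"
    if t: "t = y / 2 * n1 - x / 2 * n2 + n3" for n1 n2 n3 t
  proof -
    have "heis_metric (graph_param f z) (n1, n2, n3) (graph_tangent f z u) =
        fst u * (n1 + p * t) + snd u * (n2 + q * t)" for u
      by (simp add: T t graph_param_def z algebra_simps)
    moreover have "(\<forall>u. fst u * (n1 + p * t) + snd u * (n2 + q * t) = 0) \<longleftrightarrow>
        n1 + p * t = 0 \<and> n2 + q * t = 0" (is "?L = ?R")
    proof
      assume L: ?L
      show ?R using L[rule_format, of "(1, 0)"] L[rule_format, of "(0, 1)"] by simp
    qed simp
    moreover have "heis_metric (graph_param f z) (n1, n2, n3) (n1, n2, n3) = n1\<^sup>2 + n2\<^sup>2 + t\<^sup>2"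
      by (simp add: t graph_param_def z power2_eq_square)
    moreover have "snd (snd (translate_to_identity (graph_param f z) (n1, n2, n3))) = t"
      by (simp add: t graph_param_def z translate_to_identity_eq algebra_simps diff_divide_distrib)
    moreover have "n1 + p * t = 0 \<and> n2 + q * t = 0 \<longleftrightarrow> n1 = - p * t \<and> n2 = - q * t"
      by auto
    ultimately show ?thesis by simp
  qed
  have norm: "(p * t)\<^sup>2 + (q * t)\<^sup>2 + t\<^sup>2 = 1 \<longleftrightarrow> t = 1 / W" if "t > 0" for t
  proof -
    have "(p * t)\<^sup>2 + (q * t)\<^sup>2 + t\<^sup>2 = (W * t)\<^sup>2"
      by (simp add: power_mult_distrib W2 algebra_simps)
    moreover have "(W * t)\<^sup>2 = 1 \<longleftrightarrow> W * t = 1"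
      using W that by (metis abs_of_pos mult_pos_pos power2_eq_1_iff abs_1 abs_minus_cancel)
    ultimately show ?thesis using W by (simp add: field_simps)
  qed
  have "unit_normal f z = n0"
    unfolding unit_normal_def
  proof (rule the_equality)
    have t0: "1 / W = y / 2 * (- p / W) - x / 2 * (- q / W) + (1 + (y * p - x * q) / 2) / W"
      using W by (simp add: field_simps)
    have P0: "?P (- p / W, - q / W, (1 + (y * p - x * q) / 2) / W)"
      unfolding char[OF t0] using norm[of "1 / W"] W by simp
    have n0_eq: "n0 = (- p / W, - q / W, (1 + (y * p - x * q) / 2) / W)"
      by (simp add: n0_def)
    show "?P n0" unfolding n0_eq by (rule P0)
  next
    fix n assume n: "?P n"
    obtain n1 n2 n3 where n_eq: "n = (n1, n2, n3)" by (cases n)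
    define t where "t = y / 2 * n1 - x / 2 * n2 + n3"
    from n have *: "n1 = - p * t" "n2 = - q * t" "n1\<^sup>2 + n2\<^sup>2 + t\<^sup>2 = 1" "0 < t"
      unfolding n_eq char[OF t_def] by auto
    then have "t = 1 / W" using norm[of t] by simp
    moreover have "n3 = t - y / 2 * n1 + x / 2 * n2" by (simp add: t_def)
    ultimately show "n = n0"
      using * by (simp add: n_eq n0_def) (simp add: algebra_simps add_divide_distrib diff_divide_distrib)
  qed
  then show ?thesis by (simp add: n0_def W_def z)
qed

text \<open>The formula \<open>\<phi> = (-p, -q)\<close> for the Gauss map.\<close>

lemma gauss_map_eq:
  assumes "f differentiable (at z)"
  shows "gauss_map f z = (- slope_p f z, - slope_q f z)"
proof -
  define p q W where "p = slope_p f z" and "q = slope_q f z" and "W = sqrt (1 + p\<^sup>2 + q\<^sup>2)"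
  have W: "W > 0"
    by (auto simp: W_def add_pos_nonneg)
  obtain x y where z: "z = (x, y)" by (cases z)
  have "translate_to_identity (graph_param f z) (unit_normal f z) = (- p / W, - q / W, 1 / W)"
    using W unfolding unit_normal_eq[OF assms] p_def[symmetric] q_def[symmetric] W_def[symmetric]
    by (simp add: graph_param_def translate_to_identity_eq z field_simps)
  with W show ?thesis
    by (simp add: gauss_map_def p_def q_def)
qed

lemma first_form_eq:
  assumes "f differentiable (at z)"
  defines "p \<equiv> slope_p f z" and "q \<equiv> slope_q f z"
  shows "first_form f z u v = (1 + p\<^sup>2) * (fst u * fst v) + p * q * (fst u * snd v + snd u * fst v)
           + (1 + q\<^sup>2) * (snd u * snd v)"
proof -
  obtain x y where z: "z = (x, y)" by (cases z)
  have fx: "partial_x f z = p - y / 2" and fy: "partial_y f z = q + x / 2"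
    by (auto simp: p_def q_def slope_p_def slope_q_def z)
  have T: "graph_tangent f (x, y) u = (fst u, snd u, fst u * (p - y / 2) + snd u * (q + x / 2))" for u
    using graph_tangent_eq[OF assms(1), of u] unfolding fx fy by (simp add: z)
  have "first_form f z u v = fst u * fst v + snd u * snd v
      + (fst u * p + snd u * q) * (fst v * p + snd v * q)"
    by (simp add: first_form_def T graph_param_def z algebra_simps)
  then show ?thesis by (simp add: algebra_simps power2_eq_square)
qed

text \<open>The mean curvature in coordinates; its vanishing is the minimal graph equation.\<close>

lemma mean_curvature_eq:
  assumes "open \<Omega>" "z \<in> \<Omega>" "Ck_on 2 \<Omega> f"
  defines "p \<equiv> slope_p f z" and "q \<equiv> slope_q f z"
  shows "mean_curvature f z =
    ((1 + q\<^sup>2) * partial_x (partial_x f) z - 2 * p * q * partial_y (partial_x f) z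
      + (1 + p\<^sup>2) * partial_y (partial_y f) z) / (2 * sqrt (1 + p\<^sup>2 + q\<^sup>2) ^ 3)"
proof -
  obtain x y where z: "z = (x, y)" by (cases z)
  define W where "W = sqrt (1 + p\<^sup>2 + q\<^sup>2)"
  have W2: "W\<^sup>2 = 1 + p\<^sup>2 + q\<^sup>2" and W: "W > 0"
    by (auto simp: W_def add_pos_nonneg)
  have diff: "f differentiable (at w)" if "w \<in> \<Omega>" for w
    using assms(3) that by (simp add: numeral_2_eq_2)
  have diff2: "(\<lambda>w. frechet_derivative f (at w) v) differentiable (at z)" for v
    using assms(2,3) unfolding numeral_2_eq_2 Ck_on.simps by blast
  have fx: "partial_x f z = p - y / 2" and fy: "partial_y f z = q + x / 2"
    by (auto simp: p_def q_def slope_p_def slope_q_def z)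
  have T: "graph_tangent f z u = (fst u, snd u, fst u * (p - y / 2) + snd u * (q + x / 2))" for u
    using graph_tangent_eq[OF diff[OF assms(2)], of u] unfolding fx fy by (simp add: z)
  have N: "unit_normal f z = (- p / W, - q / W, (1 + (y * p - x * q) / 2) / W)"
    using unit_normal_eq[OF diff[OF assms(2)]] unfolding p_def[symmetric] q_def[symmetric] W_def[symmetric]
    by (simp add: z)
  have second: "frechet_derivative (\<lambda>z. graph_tangent f z u) (at z) v =
      (0, 0, fst u * frechet_derivative (partial_x f) (at z) v + snd u * frechet_derivative (partial_y f) (at z) v)"
    for u v
  proof -
    have "((\<lambda>z. (fst u, snd u, fst u * partial_x f z + snd u * partial_y f z)) has_derivative
       (\<lambda>v. (0, 0, fst u * frechet_derivative (partial_x f) (at z) v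
                + snd u * frechet_derivative (partial_y f) (at z) v))) (at z)"
      using diff2[of "(1, 0)"] diff2[of "(0, 1)"]
      by (auto intro!: derivative_eq_intros simp: frechet_derivative_works)
    then have "((\<lambda>z. graph_tangent f z u) has_derivative
       (\<lambda>v. (0, 0, fst u * frechet_derivative (partial_x f) (at z) v
                + snd u * frechet_derivative (partial_y f) (at z) v))) (at z)"
      by (rule has_derivative_transform_within_open[OF _ assms(1,2)])
        (simp add: graph_tangent_eq diff)
    from frechet_derivative_at[OF this, symmetric] show ?thesis by (rule fun_cong)
  qed
  define r s t where "r = partial_x (partial_x f) z" and "s = partial_y (partial_x f) z"
    and "t = partial_y (partial_y f) z"
  have II: "second_form f z u v =
      heis_metric (x, y, f z) (0, 0, fst u * frechet_derivative (partial_x f) (at z) v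
          + snd u * frechet_derivative (partial_y f) (at z) v)
        (- p / W, - q / W, (1 + (y * p - x * q) / 2) / W)
      + heis_christoffel (x, y, f z)
          (fst u, snd u, fst u * (p - y / 2) + snd u * (q + x / 2))
          (fst v, snd v, fst v * (p - y / 2) + snd v * (q + x / 2))
          (- p / W, - q / W, (1 + (y * p - x * q) / 2) / W)" for u v
    unfolding second_form_def second N T by (simp add: graph_param_def z)
  note chr = heis_christoffel_def heis_metric_derivative
  have II11: "second_form f z (1, 0) (1, 0) = (r + p * q) / W"
    using W unfolding II r_def[symmetric] by (simp add: chr r_def[symmetric]) (simp add: field_simps)
  have II12: "second_form f z (1, 0) (0, 1) = (s + (q\<^sup>2 - p\<^sup>2) / 2) / W"
    using W unfolding II s_def[symmetric] by (simp add: chr s_def[symmetric]) (simp add: field_simps power2_eq_square)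
  have II22: "second_form f z (0, 1) (0, 1) = (t - p * q) / W"
    using W unfolding II t_def[symmetric] by (simp add: chr t_def[symmetric]) (simp add: field_simps)
  note I = first_form_eq[OF diff[OF assms(2)], folded p_def q_def]
  have det: "(1 + p\<^sup>2) * (1 + q\<^sup>2) - (p * q)\<^sup>2 = W\<^sup>2"
    by (simp add: W2 algebra_simps power_mult_distrib)
  have "mean_curvature f z = ((1 + q\<^sup>2) * ((r + p * q) / W) - 2 * (p * q) * ((s + (q\<^sup>2 - p\<^sup>2) / 2) / W)
      + (1 + p\<^sup>2) * ((t - p * q) / W)) / (2 * W\<^sup>2)"
    by (simp add: mean_curvature_def Let_def I II11 II12 II22 flip: det)
  also have "(1 + q\<^sup>2) * ((r + p * q) / W) - 2 * (p * q) * ((s + (q\<^sup>2 - p\<^sup>2) / 2) / W)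
      + (1 + p\<^sup>2) * ((t - p * q) / W) =
      ((1 + q\<^sup>2) * r - 2 * p * q * s + (1 + p\<^sup>2) * t) / W"
    using W by (simp add: field_simps power2_eq_square)
  finally show ?thesis
    by (simp add: r_def s_def t_def W_def power3_eq_cube power2_eq_square)
qed

lemma minimal_graph_iff:
  assumes "open \<Omega>" "smooth_on \<Omega> f"
  shows "minimal_graph \<Omega> f \<longleftrightarrow>
    (\<forall>z\<in>\<Omega>. (1 + (slope_q f z)\<^sup>2) * partial_x (partial_x f) z
       - 2 * slope_p f z * slope_q f z * partial_y (partial_x f) z
       + (1 + (slope_p f z)\<^sup>2) * partial_y (partial_y f) z = 0)"
proof -
  have "sqrt (1 + p\<^sup>2 + q\<^sup>2) \<noteq> 0" for p q :: real
    by (metis add_pos_nonneg less_irrefl real_sqrt_gt_zero zero_le_power2 zero_less_one)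
  moreover have "Ck_on 2 \<Omega> f"
    using assms(2) unfolding smooth_on_def by blast
  ultimately show ?thesis
    unfolding minimal_graph_def
    by (intro ball_cong) (simp_all add: mean_curvature_eq[OF assms(1)])
qed

end

theory Submission
  imports Defs
begin

text \<open>
  The Gauss map is \<open>\<phi> = (-p, -q)\<close>, so \<open>d\<phi> = -J\<close> for the matrix \<open>J\<close> with rows \<open>(p\<^sub>x, p\<^sub>y)\<close> and
  \<open>(q\<^sub>x, q\<^sub>y)\<close>. The coincidence behind the theorem is that the Gans metric at \<open>\<phi>(z)\<close> has as its
  matrix the inverse of the matrix \<open>I\<close> of the first fundamental form at \<open>z\<close>. Put \<open>A = I\<inverse> J\<close>.

  Conformality reads \<open>J\<^sup>T I\<inverse> J = \<lambda> I\<close> and minimality reads \<open>tr A = 0\<close>, that is \<open>A\<^sup>2 = - det A\<close> by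
  Cayley-Hamilton. Multiplying the first identity by \<open>A\<close> on the right gives \<open>J\<^sup>T A\<^sup>2 = \<lambda> J\<close>, hence
  \<open>\<lambda> J = - det A J\<^sup>T\<close> (\<open>conformal_traceless_transpose\<close>). So \<open>J\<close> is a nonzero multiple of its
  transpose and is symmetric or antisymmetric. But the Heisenberg group makes
  \<open>J\<close> the Hessian of \<open>f\<close> plus the fixed antisymmetric matrix with off-diagonal entries
  \<open>1/2\<close> and \<open>-1/2\<close>, and the Hessian is symmetric (\<open>Ck_on_2_second_derivative_symmetric\<close>). Hence
  \<open>J\<close> is not symmetric, so it is antisymmetric, and the Hessian of \<open>f\<close> vanishes at that point
  (\<open>hessian_zero_if_conformal\<close>). This being so at every point of a connected open set, \<open>f\<close> is
  affine (\<open>affine_if_hessian_zero\<close>).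

  Conversely, if the Hessian vanishes, then \<open>J\<close> is half the quarter-turn matrix \<open>R\<close>, and
  \<open>R\<^sup>T I\<inverse> R = I / det I\<close> holds for every invertible symmetric \<open>2 \<times> 2\<close> matrix \<open>I\<close>; the Gauss map is then
  conformal with \<open>\<lambda> = 1 / (4 (1 + p\<^sup>2 + q\<^sup>2))\<close> (\<open>conformal_if_hessian_zero\<close>).
\<close>

section \<open>Symmetry of second derivatives\<close>

lemma has_real_derivative_along_line:
  fixes f :: "'a::real_normed_vector \<Rightarrow> real"
  assumes "f differentiable (at (a + s *\<^sub>R v))"
  shows "((\<lambda>s. f (a + s *\<^sub>R v)) has_real_derivative
    frechet_derivative f (at (a + s *\<^sub>R v)) v) (at s)"
proof -
  let ?D = "frechet_derivative f (at (a + s *\<^sub>R v))"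
  have D: "(f has_derivative ?D) (at (a + s *\<^sub>R v))"
    using assms frechet_derivative_works by blast
  have "((\<lambda>s. a + s *\<^sub>R v) has_derivative (\<lambda>h. h *\<^sub>R v)) (at s)"
    by (auto intro!: derivative_eq_intros)
  from has_derivative_compose[OF this D]
  have "((\<lambda>s. f (a + s *\<^sub>R v)) has_derivative (\<lambda>h. ?D (h *\<^sub>R v))) (at s)" .
  moreover have "?D (h *\<^sub>R v) = ?D v * h" for h
    using linear_scale[OF has_derivative_linear[OF D], of h v] by simp
  ultimately show ?thesis
    by (simp add: has_field_derivative_def)
qed

text \<open>The second difference of \<open>f\<close> over a parallelogram does not change when its two sides are
  exchanged, whereas its expression by a second derivative does; comparing the two expressions on
  small parallelograms proves the symmetry of second derivatives. The expression results from two
  applications of the mean value theorem, first to the difference of \<open>f\<close> across the side \<open>v\<close> as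
  one moves along \<open>u\<close>, then to the derivative in the direction \<open>u\<close> along \<open>v\<close>.\<close>

lemma second_difference_mean_value:
  fixes f :: "'a::real_normed_vector \<Rightarrow> real"
  assumes "h > 0"
    and f: "\<And>\<sigma> \<tau>. 0 \<le> \<sigma> \<Longrightarrow> \<sigma> \<le> h \<Longrightarrow> 0 \<le> \<tau> \<Longrightarrow> \<tau> \<le> h \<Longrightarrow>
      f differentiable (at (z + \<sigma> *\<^sub>R u + \<tau> *\<^sub>R v))"
    and f': "\<And>\<sigma> \<tau>. 0 \<le> \<sigma> \<Longrightarrow> \<sigma> \<le> h \<Longrightarrow> 0 \<le> \<tau> \<Longrightarrow> \<tau> \<le> h \<Longrightarrow>
      (\<lambda>w. frechet_derivative f (at w) u) differentiable (at (z + \<sigma> *\<^sub>R u + \<tau> *\<^sub>R v))"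
  obtains \<sigma> \<tau> where "0 \<le> \<sigma>" "\<sigma> \<le> h" "0 \<le> \<tau>" "\<tau> \<le> h"
    "f (z + h *\<^sub>R u + h *\<^sub>R v) - f (z + h *\<^sub>R u) - f (z + h *\<^sub>R v) + f z =
      h\<^sup>2 * frechet_derivative (\<lambda>w. frechet_derivative f (at w) u) (at (z + \<sigma> *\<^sub>R u + \<tau> *\<^sub>R v)) v"
proof -
  define D where "D w = frechet_derivative f (at w) u" for w
  define g where "g s = f (z + h *\<^sub>R v + s *\<^sub>R u) - f (z + s *\<^sub>R u)" for s
  have "(g has_real_derivative D (z + h *\<^sub>R v + s *\<^sub>R u) - D (z + s *\<^sub>R u)) (at s)"
    if "0 \<le> s" "s \<le> h" for s
    unfolding g_def[abs_def] D_def
    using f[of s h] f[of s 0] that \<open>h > 0\<close>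
    by (intro DERIV_diff has_real_derivative_along_line) (simp_all add: add_ac)
  from MVT2[of 0 h g, OF \<open>h > 0\<close> this] obtain \<sigma> where \<sigma>: "0 < \<sigma>" "\<sigma> < h"
    "g h - g 0 = h * (D (z + h *\<^sub>R v + \<sigma> *\<^sub>R u) - D (z + \<sigma> *\<^sub>R u))"
    by auto
  have "((\<lambda>t. D (z + \<sigma> *\<^sub>R u + t *\<^sub>R v)) has_real_derivative
      frechet_derivative D (at (z + \<sigma> *\<^sub>R u + t *\<^sub>R v)) v) (at t)" if "0 \<le> t" "t \<le> h" for t
    using f'[of \<sigma> t] \<sigma> that
    by (intro has_real_derivative_along_line) (simp add: D_def[abs_def])
  from MVT2[of 0 h "\<lambda>t. D (z + \<sigma> *\<^sub>R u + t *\<^sub>R v)", OF \<open>h > 0\<close> this] obtain \<tau> where \<tau>: "0 < \<tau>" "\<tau> < h"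
    "D (z + \<sigma> *\<^sub>R u + h *\<^sub>R v) - D (z + \<sigma> *\<^sub>R u) =
      h * frechet_derivative D (at (z + \<sigma> *\<^sub>R u + \<tau> *\<^sub>R v)) v"
    by auto
  have "g h - g 0 = h * (h * frechet_derivative D (at (z + \<sigma> *\<^sub>R u + \<tau> *\<^sub>R v)) v)"
    unfolding \<sigma>(3) \<tau>(3)[symmetric] by (simp add: add_ac)
  then show ?thesis
    using \<sigma>(1,2) \<tau>(1,2)
    by (intro that[of \<sigma> \<tau>]) (simp_all add: g_def D_def[abs_def] power2_eq_square algebra_simps)
qed

lemma Ck_on_2_second_derivative_symmetric:
  fixes f :: "'a::real_normed_vector \<Rightarrow> real"
  assumes "open S" "z \<in> S" "Ck_on 2 S f"
  shows "frechet_derivative (\<lambda>w. frechet_derivative f (at w) u) (at z) v =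
    frechet_derivative (\<lambda>w. frechet_derivative f (at w) v) (at z) u"
proof -
  define D2 where "D2 u v w = frechet_derivative (\<lambda>w. frechet_derivative f (at w) u) (at w) v" for u v w
  have diff: "f differentiable (at w)" "(\<lambda>w. frechet_derivative f (at w) u) differentiable (at w)"
    and cont: "continuous_on S (D2 u v)" if "w \<in> S" for w u v
    using assms(3) that unfolding numeral_2_eq_2 Ck_on.simps D2_def[abs_def] by auto
  have "\<bar>D2 u v z - D2 v u z\<bar> \<le> e" if "e > 0" for e
  proof -
    have "\<forall>\<^sub>F w in nhds z. w \<in> S \<and> dist (D2 u v w) (D2 u v z) < e / 2 \<and> dist (D2 v u w) (D2 v u z) < e / 2"
    proof (intro eventually_conj)
      show "\<forall>\<^sub>F w in nhds z. w \<in> S"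
        using assms(1,2) by (rule eventually_nhds_in_open)
      have "(D2 a b \<longlongrightarrow> D2 a b z) (nhds z)" for a b
        using cont[OF assms(2), of a b] assms(1,2)
        by (simp add: continuous_on_eq_continuous_at isCont_def tendsto_nhds_iff)
      from tendstoD[OF this, of "e / 2"]
      show "\<forall>\<^sub>F w in nhds z. dist (D2 u v w) (D2 u v z) < e / 2"
        "\<forall>\<^sub>F w in nhds z. dist (D2 v u w) (D2 v u z) < e / 2"
        using that by simp_all
    qed
    then obtain d where d: "d > 0" and
      near: "\<And>w. dist w z < d \<Longrightarrow> w \<in> S"
        "\<And>w. dist w z < d \<Longrightarrow> \<bar>D2 u v w - D2 u v z\<bar> < e / 2"
        "\<And>w. dist w z < d \<Longrightarrow> \<bar>D2 v u w - D2 v u z\<bar> < e / 2"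
      unfolding eventually_nhds_metric dist_real_def by blast
    \<comment> \<open>The parallelogram with sides \<open>h u\<close> and \<open>h v\<close> at \<open>z\<close> must lie in the ball of radius \<open>d\<close>; the
      summand \<open>1\<close> guards against \<open>u = v = 0\<close>.\<close>
    define h where "h = d / (2 * (norm u + norm v + 1))"
    have h: "h > 0"
      using d by (simp add: h_def add_nonneg_pos)
    have hd: "h * (norm u + norm v) < d"
    proof -
      have n: "0 < norm u + norm v + 1" by (simp add: add_nonneg_pos)
      have "h * (norm u + norm v) < h * (2 * (norm u + norm v + 1))"
        using h n by (intro mult_strict_left_mono) auto
      also have "\<dots> = d" using n by (simp add: h_def)
      finally show ?thesis .
    qed
    have close: "dist (z + \<sigma> *\<^sub>R a + \<tau> *\<^sub>R b) z < d"
      if "0 \<le> \<sigma>" "\<sigma> \<le> h" "0 \<le> \<tau>" "\<tau> \<le> h" "norm a + norm b = norm u + norm v" for \<sigma> \<tau> a b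
    proof -
      have "dist (z + \<sigma> *\<^sub>R a + \<tau> *\<^sub>R b) z = norm (\<sigma> *\<^sub>R a + \<tau> *\<^sub>R b)"
        by (simp add: dist_norm algebra_simps)
      also have "\<dots> \<le> \<sigma> * norm a + \<tau> * norm b"
        using norm_triangle_ineq[of "\<sigma> *\<^sub>R a" "\<tau> *\<^sub>R b"] that by simp
      also have "\<dots> \<le> h * norm a + h * norm b"
        using that by (intro add_mono mult_right_mono) auto
      also have "\<dots> = h * (norm u + norm v)"
        unfolding that(5)[symmetric] by (simp add: algebra_simps)
      finally show ?thesis using hd by simp
    qed
    obtain \<sigma> \<tau> where 1: "0 \<le> \<sigma>" "\<sigma> \<le> h" "0 \<le> \<tau>" "\<tau> \<le> h"
      "f (z + h *\<^sub>R u + h *\<^sub>R v) - f (z + h *\<^sub>R u) - f (z + h *\<^sub>R v) + f z =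
        h\<^sup>2 * D2 u v (z + \<sigma> *\<^sub>R u + \<tau> *\<^sub>R v)"
      unfolding D2_def
      by (rule second_difference_mean_value[OF h, of f z u v]) (auto intro!: diff near(1) close)
    obtain \<sigma>' \<tau>' where 2: "0 \<le> \<sigma>'" "\<sigma>' \<le> h" "0 \<le> \<tau>'" "\<tau>' \<le> h"
      "f (z + h *\<^sub>R v + h *\<^sub>R u) - f (z + h *\<^sub>R v) - f (z + h *\<^sub>R u) + f z =
        h\<^sup>2 * D2 v u (z + \<sigma>' *\<^sub>R v + \<tau>' *\<^sub>R u)"
      unfolding D2_def
      by (rule second_difference_mean_value[OF h, of f z v u]) (auto intro!: diff near(1) close)
    have "h\<^sup>2 * D2 u v (z + \<sigma> *\<^sub>R u + \<tau> *\<^sub>R v) = h\<^sup>2 * D2 v u (z + \<sigma>' *\<^sub>R v + \<tau>' *\<^sub>R u)"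
      unfolding 1(5)[symmetric] 2(5)[symmetric] by (simp add: add_ac)
    then have "D2 u v (z + \<sigma> *\<^sub>R u + \<tau> *\<^sub>R v) = D2 v u (z + \<sigma>' *\<^sub>R v + \<tau>' *\<^sub>R u)"
      using h by simp
    moreover have "\<bar>D2 u v (z + \<sigma> *\<^sub>R u + \<tau> *\<^sub>R v) - D2 u v z\<bar> < e / 2"
      using 1 by (intro near(2) close) auto
    moreover have "\<bar>D2 v u (z + \<sigma>' *\<^sub>R v + \<tau>' *\<^sub>R u) - D2 v u z\<bar> < e / 2"
      using 2 by (intro near(3) close) auto
    ultimately show ?thesis by linarith
  qed
  then have "\<bar>D2 u v z - D2 v u z\<bar> \<le> 0"
    by (rule field_le_epsilon) simp
  then show ?thesis by (simp add: D2_def)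
qed

section \<open>Pointwise algebra of the conformality condition\<close>

text \<open>Let \<open>J\<close> have the rows \<open>(r, b)\<close> and \<open>(c, t)\<close>, and let \<open>I\<close> have the rows \<open>(E, F)\<close> and \<open>(F, G)\<close>.
  With \<open>I\<inverse>\<close> replaced by the adjugate \<open>I\<^sup>*\<close> to avoid denominators, the hypotheses are the entries
  of \<open>J\<^sup>T I\<^sup>* J = l I\<close> together with \<open>tr (I\<^sup>* J) = 0\<close>, and the conclusions are the entries of
  \<open>l J = - det J J\<^sup>T\<close>. By Cayley-Hamilton \<open>(I\<^sup>* J)\<^sup>2 = - det I det J\<close>, so multiplying the matrix
  hypothesis by \<open>I\<^sup>* J\<close> on the right gives the conclusion multiplied by \<open>det I\<close>.\<close>

lemma conformal_traceless_transpose: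
  fixes E F G b c r t l :: real
  assumes D: "E * G - F\<^sup>2 > 0"
    and "G * r\<^sup>2 - 2 * F * r * c + E * c\<^sup>2 = l * E"
    and "G * r * b - F * (r * t + c * b) + E * c * t = l * F"
    and "G * b\<^sup>2 - 2 * F * b * t + E * t\<^sup>2 = l * G"
    and trace: "G * r - F * (b + c) + E * t = 0"
  shows "l * r = - (r * t - b * c) * r" "l * t = - (r * t - b * c) * t"
    "l * b = - (r * t - b * c) * c" "l * c = - (r * t - b * c) * b"
proof -
  have "(E * G - F\<^sup>2) * (l * r + (r * t - b * c) * r) = 0"
    "(E * G - F\<^sup>2) * (l * t + (r * t - b * c) * t) = 0"
    "(E * G - F\<^sup>2) * (l * b + (r * t - b * c) * c) = 0"
    "(E * G - F\<^sup>2) * (l * c + (r * t - b * c) * b) = 0"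
    using assms(2-) by algebra+
  then show "l * r = - (r * t - b * c) * r" "l * t = - (r * t - b * c) * t"
    "l * b = - (r * t - b * c) * c" "l * c = - (r * t - b * c) * b"
    using D by (simp_all only: mult_eq_0_iff eq_neg_iff_add_eq_0 mult_minus_left) auto
qed

text \<open>Comparing the off-diagonal entries of \<open>l J = - det J J\<^sup>T\<close> forces \<open>det J = l\<close> unless \<open>J\<close> is
  symmetric, and then \<open>J = - J\<^sup>T\<close>.\<close>

lemma conformal_traceless_antisymmetric:
  fixes E F G b c r t l :: real
  assumes "E * G - F\<^sup>2 > 0"
    and "G * r\<^sup>2 - 2 * F * r * c + E * c\<^sup>2 = l * E"
    and "G * r * b - F * (r * t + c * b) + E * c * t = l * F"
    and "G * b\<^sup>2 - 2 * F * b * t + E * t\<^sup>2 = l * G"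
    and "G * r - F * (b + c) + E * t = 0"
    and "l > 0" and "b \<noteq> c"
  shows "r = 0" "t = 0" "b = - c"
proof -
  define d where "d = r * t - b * c"
  note tr = conformal_traceless_transpose[OF assms(1-5), folded d_def]
  have "(l - d) * (b - c) = 0" using tr by (simp add: algebra_simps)
  then have "d = l" using \<open>b \<noteq> c\<close> by simp
  with tr \<open>l > 0\<close> show "r = 0" "t = 0" by auto
  from tr(3) \<open>d = l\<close> \<open>l > 0\<close> show "b = - c"
    by (metis mult_left_cancel mult_minus_left mult_minus_right less_irrefl)
qed

section \<open>The differential of the Gauss map\<close>

lemma linear_pair_coords:
  assumes "linear (D :: real \<times> real \<Rightarrow> real)"
  shows "D u = fst u * D (1, 0) + snd u * D (0, 1)"
proof -
  have "D u = D (fst u *\<^sub>R (1, 0) + snd u *\<^sub>R (0, 1))" by simp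
  then show ?thesis
    by (simp only: linear_add[OF assms] linear_scale[OF assms] real_scaleR_def)
qed

lemma gauss_map_derivative:
  assumes "open \<Omega>" "z \<in> \<Omega>" "Ck_on 2 \<Omega> f"
  shows "frechet_derivative (gauss_map f) (at z) u =
    (- (fst u * partial_x (partial_x f) z + snd u * (partial_y (partial_x f) z + 1 / 2)),
     - (fst u * (partial_x (partial_y f) z - 1 / 2) + snd u * partial_y (partial_y f) z))"
proof -
  have diff: "f differentiable (at w)" if "w \<in> \<Omega>" for w
    using assms(3) that by (simp add: numeral_2_eq_2)
  have D: "((\<lambda>w. frechet_derivative f (at w) v) has_derivative
      frechet_derivative (\<lambda>w. frechet_derivative f (at w) v) (at z)) (at z)" for v
    using assms(2,3) unfolding numeral_2_eq_2 Ck_on.simps frechet_derivative_works[symmetric] by blast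
  have "((\<lambda>w. (- (partial_x f w + snd w / 2), - (partial_y f w - fst w / 2))) has_derivative
      (\<lambda>u. (- (frechet_derivative (partial_x f) (at z) u + snd u / 2),
        - (frechet_derivative (partial_y f) (at z) u - fst u / 2)))) (at z)"
    by (auto intro!: derivative_eq_intros D)
  then have "(gauss_map f has_derivative
      (\<lambda>u. (- (frechet_derivative (partial_x f) (at z) u + snd u / 2),
        - (frechet_derivative (partial_y f) (at z) u - fst u / 2)))) (at z)"
    by (rule has_derivative_transform_within_open[OF _ assms(1,2)])
      (simp add: gauss_map_eq diff slope_p_def slope_q_def)
  from frechet_derivative_at[OF this, symmetric] show ?thesis
    using linear_pair_coords[OF has_derivative_linear[OF D[of "(1, 0)"]], of u]
      linear_pair_coords[OF has_derivative_linear[OF D[of "(0, 1)"]], of u]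
    by (simp add: algebra_simps)
qed

section \<open>Affine functions and vanishing Hessian\<close>

text \<open>The first derivatives are constant on the connected set, so subtracting the linear function with
  these slopes leaves a function with zero derivative.\<close>

lemma affine_if_hessian_zero:
  assumes "open \<Omega>" "connected \<Omega>" "Ck_on 2 \<Omega> f"
    and zero: "\<And>z. z \<in> \<Omega> \<Longrightarrow> partial_x (partial_x f) z = 0 \<and> partial_y (partial_x f) z = 0
      \<and> partial_x (partial_y f) z = 0 \<and> partial_y (partial_y f) z = 0"
  shows "\<exists>a b c :: real. \<forall>x y. (x, y) \<in> \<Omega> \<longrightarrow> f (x, y) = a * x + b * y + c"
proof (cases "\<Omega> = {}")
  case False
  then obtain z0 where z0: "z0 \<in> \<Omega>" by blast
  have D: "(f has_derivative frechet_derivative f (at w)) (at w)" if "w \<in> \<Omega>" for w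
    using assms(3) that by (simp add: numeral_2_eq_2 frechet_derivative_works)
  have const: "g w = g z0"
    if "\<And>z. z \<in> \<Omega> \<Longrightarrow> (g has_derivative (\<lambda>_. 0)) (at z)" "w \<in> \<Omega>"
    for g :: "real \<times> real \<Rightarrow> real" and w
    using has_derivative_zero_unique_connected[OF assms(1,2), of g w z0] that z0 by metis
  have second: "((\<lambda>w. frechet_derivative f (at w) e) has_derivative (\<lambda>_. 0)) (at z)"
    if "z \<in> \<Omega>" "e = (1, 0) \<or> e = (0, 1)" for z e
  proof -
    let ?D = "frechet_derivative (\<lambda>w. frechet_derivative f (at w) e) (at z)"
    have *: "((\<lambda>w. frechet_derivative f (at w) e) has_derivative ?D) (at z)"
      using assms(3) that(1) unfolding numeral_2_eq_2 Ck_on.simps frechet_derivative_works[symmetric]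
      by blast
    have "?D u = 0" for u
      using linear_pair_coords[OF has_derivative_linear[OF *], of u] zero[OF that(1)] that(2) by auto
    then have "?D = (\<lambda>_. 0)" by (rule ext)
    with * show ?thesis by simp
  qed
  define a b where "a = partial_x f z0" and "b = partial_y f z0"
  have a: "partial_x f w = a" and b: "partial_y f w = b" if "w \<in> \<Omega>" for w
    using const[OF second that] by (auto simp: a_def b_def)
  define g where "g w = f w - (a * fst w + b * snd w)" for w
  have "(g has_derivative (\<lambda>_. 0)) (at w)" if "w \<in> \<Omega>" for w
  proof -
    have "(g has_derivative (\<lambda>u. frechet_derivative f (at w) u - (a * fst u + b * snd u))) (at w)"
      unfolding g_def[abs_def] by (auto intro!: derivative_eq_intros D that)
    moreover have "frechet_derivative f (at w) u - (a * fst u + b * snd u) = 0" for u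
      using linear_pair_coords[OF has_derivative_linear[OF D[OF that]], of u] a[OF that] b[OF that]
      by (simp add: algebra_simps)
    ultimately show ?thesis by simp
  qed
  from const[OF this] have "f w = a * fst w + b * snd w + g z0" if "w \<in> \<Omega>" for w
    using that by (simp add: g_def algebra_simps)
  then show ?thesis by fastforce
qed simp

lemma hessian_zero_if_affine:
  fixes f :: "real \<times> real \<Rightarrow> real"
  assumes "open \<Omega>" "z \<in> \<Omega>"
    and aff: "\<And>x y. (x, y) \<in> \<Omega> \<Longrightarrow> f (x, y) = a * x + b * y + c"
  shows "frechet_derivative (\<lambda>w. frechet_derivative f (at w) u) (at z) = (\<lambda>_. 0)"
proof -
  have 1: "frechet_derivative f (at w) u = a * fst u + b * snd u" if "w \<in> \<Omega>" for w
  proof -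
    have "((\<lambda>w. a * fst w + b * snd w + c) has_derivative (\<lambda>u. a * fst u + b * snd u)) (at w)"
      by (auto intro!: derivative_eq_intros)
    then have "(f has_derivative (\<lambda>u. a * fst u + b * snd u)) (at w)"
      by (rule has_derivative_transform_within_open[OF _ assms(1) that]) (auto simp: aff)
    from frechet_derivative_at[OF this, symmetric] show ?thesis by simp
  qed
  have "((\<lambda>w. frechet_derivative f (at w) u) has_derivative (\<lambda>_. 0)) (at z)"
    by (rule has_derivative_transform_within_open[OF has_derivative_const assms(1,2)]) (simp add: 1)
  from frechet_derivative_at[OF this, symmetric] show ?thesis .
qed

section \<open>Planes and conformal Gauss maps\<close>

lemma hessian_zero_if_conformal:
  assumes "open \<Omega>" "smooth_on \<Omega> f" "minimal_graph \<Omega> f" "conformal_gauss_map \<Omega> f" "z \<in> \<Omega>"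
  shows "partial_x (partial_x f) z = 0 \<and> partial_y (partial_x f) z = 0
    \<and> partial_x (partial_y f) z = 0 \<and> partial_y (partial_y f) z = 0"
proof -
  have C2: "Ck_on 2 \<Omega> f" using assms(2) by (simp add: smooth_on_def)
  have diff: "f differentiable (at z)"
    using C2 assms(5) by (simp add: numeral_2_eq_2)
  define p q where "p = slope_p f z" and "q = slope_q f z"
  define r b c t where "r = partial_x (partial_x f) z" and "b = partial_y (partial_x f) z + 1 / 2"
    and "c = partial_x (partial_y f) z - 1 / 2" and "t = partial_y (partial_y f) z"
  define W where "W = 1 + p\<^sup>2 + q\<^sup>2"
  have W: "W > 0" by (simp add: W_def add_pos_nonneg)
  \<comment> \<open>The Heisenberg terms \<open>y/2\<close> and \<open>-x/2\<close> in \<open>p\<close> and \<open>q\<close> contribute the curl \<open>p\<^sub>y - q\<^sub>x = 1\<close>.\<close>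
  have schwarz: "b - c = 1"
    using Ck_on_2_second_derivative_symmetric[OF assms(1,5) C2, of "(1, 0)" "(0, 1)"]
    by (simp add: b_def c_def)
  obtain l where l: "l > 0"
    and "\<And>u v. gans_metric (gauss_map f z) (frechet_derivative (gauss_map f) (at z) u)
      (frechet_derivative (gauss_map f) (at z) v) = l * first_form f z u v"
    using assms(4,5) unfolding conformal_gauss_map_def by blast
  then have conf0: "gans_metric (- p, - q)
        (- (fst u * r + snd u * b), - (fst u * c + snd u * t))
        (- (fst v * r + snd v * b), - (fst v * c + snd v * t)) =
      l * ((1 + p\<^sup>2) * (fst u * fst v) + p * q * (fst u * snd v + snd u * fst v)
           + (1 + q\<^sup>2) * (snd u * snd v))" for u v
    unfolding gauss_map_derivative[OF assms(1,5) C2] gauss_map_eq[OF diff] first_form_eq[OF diff]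
      p_def q_def r_def b_def c_def t_def by blast
  have conf: "(1 + q\<^sup>2) * (u1 * r + u2 * b) * (v1 * r + v2 * b)
      - p * q * ((u1 * r + u2 * b) * (v1 * c + v2 * t) + (u1 * c + u2 * t) * (v1 * r + v2 * b))
      + (1 + p\<^sup>2) * (u1 * c + u2 * t) * (v1 * c + v2 * t) =
      l * W * ((1 + p\<^sup>2) * (u1 * v1) + p * q * (u1 * v2 + u2 * v1) + (1 + q\<^sup>2) * (u2 * v2))"
    for u1 u2 v1 v2
    using conf0[of "(u1, u2)" "(v1, v2)"] W
    by (simp add: W_def[symmetric] divide_eq_eq mult_ac del: minus_add_distrib)
  \<comment> \<open>Evaluation on the coordinate basis. The factor \<open>W = det I\<close> enters \<open>l * W\<close> because the adjugate
    replaces the inverse of the first fundamental form.\<close>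
  have E: "(1 + q\<^sup>2) * r\<^sup>2 - 2 * (p * q) * r * c + (1 + p\<^sup>2) * c\<^sup>2 = (l * W) * (1 + p\<^sup>2)"
    using conf[of 1 0 1 0] by (simp add: power2_eq_square algebra_simps)
  have F: "(1 + q\<^sup>2) * r * b - (p * q) * (r * t + c * b) + (1 + p\<^sup>2) * c * t = (l * W) * (p * q)"
    using conf[of 1 0 0 1] by (simp add: power2_eq_square algebra_simps)
  have G: "(1 + q\<^sup>2) * b\<^sup>2 - 2 * (p * q) * b * t + (1 + p\<^sup>2) * t\<^sup>2 = (l * W) * (1 + q\<^sup>2)"
    using conf[of 0 1 0 1] by (simp add: power2_eq_square algebra_simps)
  have b_c: "b + c = 2 * (b - 1 / 2)"
    using schwarz by simp
  \<comment> \<open>In the trace, the opposite terms \<open>1/2\<close> and \<open>-1/2\<close> of \<open>b\<close> and \<open>c\<close> cancel, which turns the minimal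
    graph equation into the vanishing of the trace.\<close>
  have "(1 + q\<^sup>2) * r - 2 * p * q * (b - 1 / 2) + (1 + p\<^sup>2) * t = 0"
    using assms(3,5) minimal_graph_iff[OF assms(1,2)]
    by (simp add: p_def q_def r_def b_def t_def)
  then have T: "(1 + q\<^sup>2) * r - (p * q) * (b + c) + (1 + p\<^sup>2) * t = 0"
    unfolding b_c by (simp add: algebra_simps)
  have det: "(1 + p\<^sup>2) * (1 + q\<^sup>2) - (p * q)\<^sup>2 > 0"
    using W by (simp add: W_def algebra_simps power_mult_distrib)
  have "r = 0" "t = 0" "b = - c"
    using conformal_traceless_antisymmetric[OF det E F G T] l W schwarz by auto
  then show ?thesis using schwarz by (simp add: r_def b_def c_def t_def)
qed

text \<open>Here \<open>d\<phi>\<close> is a quarter turn scaled by \<open>1/2\<close>, and a quarter turn carries the first fundamental form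
  to its adjugate. As the Gans metric is that adjugate divided by the determinant
  \<open>1 + p\<^sup>2 + q\<^sup>2\<close>, pulling it back returns the first fundamental form up to a factor.\<close>

lemma conformal_if_hessian_zero:
  assumes "open \<Omega>" "Ck_on 2 \<Omega> f"
    and zero: "\<And>z u. z \<in> \<Omega> \<Longrightarrow> frechet_derivative (\<lambda>w. frechet_derivative f (at w) u) (at z) = (\<lambda>_. 0)"
  shows "conformal_gauss_map \<Omega> f"
  unfolding conformal_gauss_map_def
proof (intro conjI ballI exI[of _ "\<lambda>z. 1 / (4 * (1 + (slope_p f z)\<^sup>2 + (slope_q f z)\<^sup>2))"] allI)
  fix z assume z: "z \<in> \<Omega>"
  have D: "frechet_derivative (gauss_map f) (at z) u = (- snd u / 2, fst u / 2)" for u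
    using gauss_map_derivative[OF assms(1) z assms(2), of u] by (simp add: zero[OF z])
  show "frechet_derivative (gauss_map f) (at z) \<noteq> (\<lambda>_. 0)"
    using D[of "(1, 0)"] by (auto simp: zero_prod_def)
  show "0 < 1 / (4 * (1 + (slope_p f z)\<^sup>2 + (slope_q f z)\<^sup>2))"
    by (simp add: add_pos_nonneg)
  fix u v
  have diff: "f differentiable (at z)"
    using assms(2) z by (simp add: numeral_2_eq_2)
  define p q where "p = slope_p f z" and "q = slope_q f z"
  have "gans_metric (- p, - q) (- snd u / 2, fst u / 2) (- snd v / 2, fst v / 2) =
      ((1 + q\<^sup>2) * (- snd u / 2) * (- snd v / 2)
        - p * q * ((- snd u / 2) * (fst v / 2) + (fst u / 2) * (- snd v / 2))
        + (1 + p\<^sup>2) * (fst u / 2) * (fst v / 2)) / (1 + p\<^sup>2 + q\<^sup>2)"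
    by simp
  also have "(1 + q\<^sup>2) * (- snd u / 2) * (- snd v / 2)
        - p * q * ((- snd u / 2) * (fst v / 2) + (fst u / 2) * (- snd v / 2))
        + (1 + p\<^sup>2) * (fst u / 2) * (fst v / 2) =
      ((1 + p\<^sup>2) * (fst u * fst v) + p * q * (fst u * snd v + snd u * fst v)
        + (1 + q\<^sup>2) * (snd u * snd v)) / 4"
    by (simp add: field_simps)
  finally show "gans_metric (gauss_map f z) (frechet_derivative (gauss_map f) (at z) u)
      (frechet_derivative (gauss_map f) (at z) v) =
    1 / (4 * (1 + (slope_p f z)\<^sup>2 + (slope_q f z)\<^sup>2)) * first_form f z u v"
    unfolding D gauss_map_eq[OF diff] first_form_eq[OF diff] p_def q_def by simp
qed

theorem theorem7:
  fixes \<Omega> :: "(real \<times> real) set" and f :: "real \<times> real \<Rightarrow> real"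
  assumes "open \<Omega>" and "connected \<Omega>" and "\<Omega> \<noteq> {}"
    and "smooth_on \<Omega> f"
    and "minimal_graph \<Omega> f"
  shows "(\<exists>a b c :: real. \<forall>x y. (x, y) \<in> \<Omega> \<longrightarrow> f (x, y) = a * x + b * y + c)
    \<longleftrightarrow> conformal_gauss_map \<Omega> f"
proof
  have C2: "Ck_on 2 \<Omega> f" using assms(4) by (simp add: smooth_on_def)
  {
    assume "\<exists>a b c :: real. \<forall>x y. (x, y) \<in> \<Omega> \<longrightarrow> f (x, y) = a * x + b * y + c"
    then obtain a b c where "\<And>x y. (x, y) \<in> \<Omega> \<Longrightarrow> f (x, y) = a * x + b * y + c"
      by blast
    then show "conformal_gauss_map \<Omega> f"
      by (intro conformal_if_hessian_zero[OF assms(1) C2] hessian_zero_if_affine[OF assms(1)])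
  next
    assume "conformal_gauss_map \<Omega> f"
    then show "\<exists>a b c :: real. \<forall>x y. (x, y) \<in> \<Omega> \<longrightarrow> f (x, y) = a * x + b * y + c"
      by (intro affine_if_hessian_zero[OF assms(1,2) C2]
          hessian_zero_if_conformal[OF assms(1,4,5)])
  }
qed

end
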